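(* Let $n \ge 1$ be an integer and let $A \subseteq \mathbb{Z}_n \setminus \{0\}$ with $|A| = 6$. Then there is an ordering $(a_1,\dots,a_6)$ of the elements of $A$ such that the partial sums $s_j = \sum_{i=1}^{j} a_i$ ($1 \le j \le 6$, computed in $\mathbb{Z}_n$) are pairwise distinct. *)

theory Defs
  imports "HOL-Algebra.FiniteProduct" "HOL-Algebra.Elementary_Groups"
begin

end

theory Submission
  imports Defs
begin

text \<open>
  The first element \<open>c\<close> of the ordering only shifts the partial sums; pick it different from the sum
  of \<open>A\<close>, so that the remaining five elements have nonzero sum \<open>\<sigma>\<close>. An ordering
  \<open>b\<^sub>1, \<dots>, b\<^sub>5\<close> of them is good iff no block of consecutive terms has sum \<open>0\<close>. By passing
  to complements, this says: neighbours do not add up to \<open>0\<close>; the pairs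
  \<open>{b\<^sub>1, b\<^sub>2}\<close>, \<open>{b\<^sub>4, b\<^sub>5}\<close>, \<open>{b\<^sub>1, b\<^sub>5}\<close> do not add up to \<open>\<sigma>\<close>; and
  \<open>b\<^sub>1, b\<^sub>5 \<noteq> \<sigma>\<close>. The pairs with sum \<open>0\<close> and those with sum \<open>\<sigma>\<close> form two matchings
  on five vertices, the latter missing \<open>\<sigma>\<close>, and a path avoiding them as required always exists.
\<close>

text \<open>Lets vertices be named in stages: a case analysis fixes some of them, and
  \<open>ys\<close> names the rest.\<close>

lemma card_eq_5_obtain_containing:
  assumes "card T = 5" "distinct xs" "set xs \<subseteq> T" "length xs + k = 5"
  obtains ys where "distinct (xs @ ys)" "set (xs @ ys) = T" "length ys = k"
proof -
  have fin: "finite T"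
    using assms(1) by (metis card.infinite zero_neq_numeral)
  then obtain ys where ys: "set ys = T - set xs" "distinct ys"
    using finite_distinct_list by (metis finite_Diff)
  have "length ys = card (T - set xs)"
    using ys distinct_card by metis
  also have "\<dots> = k"
    using assms fin by (simp add: card_Diff_subset distinct_card)
  finally show thesis
    using that[of ys] ys assms(3) assms(2) by auto
qed

text \<open>A matching on five vertices has at most two edges. Make them the pairs
  \<open>p p'\<close> and \<open>q q'\<close>; then the 4-cycle \<open>p q p' q'\<close> is free of
  \<open>R\<close>. Since \<open>t\<close> meets no edge, it can be the vertex \<open>s\<close> left
  over whenever it lies in \<open>T\<close>.\<close>

lemma matching_on_five_vertices:
  assumes card: "card T = 5"
    and sym: "\<And>x y. R x y \<Longrightarrow> R y x"
    and match: "\<And>x y z. R x y \<Longrightarrow> R x z \<Longrightarrow> y = z"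
    and isolated: "\<And>x. x \<in> T \<Longrightarrow> \<not> R t x"
  obtains s p p' q q' where "distinct [s, p, p', q, q']" "set [s, p, p', q, q'] = T"
    "t \<notin> {p, p', q, q'}" "\<not> R p q" "\<not> R p q'" "\<not> R p' q" "\<not> R p' q'"
proof (cases "\<exists>p\<in>T. \<exists>p'\<in>T. p \<noteq> p' \<and> R p p'")
  case False
  obtain s where s: "s \<in> T" "t \<in> T \<Longrightarrow> s = t"
    using card by (metis card.empty ex_in_conv zero_neq_numeral)
  then have "distinct [s]" "set [s] \<subseteq> T" "length [s] + 4 = 5"
    by auto
  then obtain ys where ys: "distinct ([s] @ ys)" "set ([s] @ ys) = T" "length ys = 4"
    by (rule card_eq_5_obtain_containing[OF card])
  then obtain p p' q q' where "ys = [p, p', q, q']"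
    by (auto simp: length_Suc_conv numeral_eq_Suc)
  with ys s False show thesis
    by (intro that[of s p p' q q']) auto
next
  case True
  then obtain p p' where p: "p \<in> T" "p' \<in> T" "p \<noteq> p'" "R p p'"
    by blast
  have t_p: "t \<noteq> p" "t \<noteq> p'"
    using p isolated sym by blast+
  have only: "\<not> R x y" if "x \<in> {p, p'}" "y \<in> T" "y \<notin> {p, p'}" for x y
    using that p match sym by blast
  show thesis
  proof (cases "\<exists>q\<in>T - {p, p'}. \<exists>q'\<in>T - {p, p'}. q \<noteq> q' \<and> R q q'")
    case True
    then obtain q q' where q: "q \<in> T - {p, p'}" "q' \<in> T - {p, p'}" "q \<noteq> q'" "R q q'"
      by blast
    have "distinct [p, p', q, q']" "set [p, p', q, q'] \<subseteq> T" "length [p, p', q, q'] + 1 = 5"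
      using p q by auto
    then obtain ys where ys: "distinct ([p, p', q, q'] @ ys)" "set ([p, p', q, q'] @ ys) = T"
        "length ys = 1"
      by (rule card_eq_5_obtain_containing[OF card])
    then obtain s where s: "ys = [s]"
      by (auto simp: length_Suc_conv)
    \<comment> \<open>All four vertices are matched, so \<open>t\<close> can only be the fifth
      vertex or lie outside \<open>T\<close>.\<close>
    have "t \<noteq> q" "t \<noteq> q'"
      using q isolated sym by blast+
    then show thesis
      using ys s t_p only q by (intro that[of s p p' q q']) auto
  next
    case False
    \<comment> \<open>With just one edge \<open>p p'\<close> there is freedom in the choice of
      \<open>s\<close>, which is used to remove \<open>t\<close>.\<close>
    obtain s where "s \<in> T - {p, p'}" "t \<in> T \<Longrightarrow> s = t"
    proof (cases "t \<in> T")
      case False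
      have "\<not> T \<subseteq> set [p, p']"
        using card card_length[of "[p, p']"] card_mono[of "set [p, p']" T] by auto
      with False that show thesis
        by auto
    qed (use t_p that in auto)
    then have "distinct [p, p', s]" "set [p, p', s] \<subseteq> T" "length [p, p', s] + 2 = 5"
      and t: "t \<in> T \<Longrightarrow> s = t"
      using p by auto
    then obtain ys where ys: "distinct ([p, p', s] @ ys)" "set ([p, p', s] @ ys) = T"
        "length ys = 2"
      using card_eq_5_obtain_containing[OF card] by metis
    then obtain q q' where "ys = [q, q']"
      by (auto simp: length_Suc_conv numeral_eq_Suc)
    with ys t have s: "distinct [s, p, p', q, q']" "set [s, p, p', q, q'] = T" "t \<notin> {q, q'}"
      by auto
    then show thesis
      using t_p only by (intro that[of s p p' q q']) auto
  qed
qed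

text \<open>Putting \<open>s\<close> in the middle, with the path alternating between
  \<open>{p, p'}\<close> and \<open>{q, q'}\<close> around it, settles all conditions on
  \<open>R\<close> and \<open>t\<close>: the three pairs concerned are edges of the 4-cycle, and the
  ends differ from \<open>s\<close>. Only \<open>N\<close> remains to be avoided.\<close>

lemma path_avoiding_matchings:
  assumes card: "card T = 5"
    and sym_R: "\<And>x y. R x y \<Longrightarrow> R y x"
    and match_R: "\<And>x y z. R x y \<Longrightarrow> R x z \<Longrightarrow> y = z"
    and isolated: "\<And>x. x \<in> T \<Longrightarrow> \<not> R t x"
    and sym_N: "\<And>x y. N x y \<Longrightarrow> N y x"
    and match_N: "\<And>x y z. N x y \<Longrightarrow> N x z \<Longrightarrow> y = z"
  obtains b1 b2 b3 b4 b5 where "distinct [b1, b2, b3, b4, b5]" "set [b1, b2, b3, b4, b5] = T"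
    "\<not> N b1 b2" "\<not> N b2 b3" "\<not> N b3 b4" "\<not> N b4 b5"
    "\<not> R b1 b2" "\<not> R b4 b5" "\<not> R b1 b5" "b1 \<noteq> t" "b5 \<noteq> t"
proof -
  obtain s p p' q q' where *: "distinct [s, p, p', q, q']" "set [s, p, p', q, q'] = T"
    "t \<notin> {p, p', q, q'}" "\<not> R p q" "\<not> R p q'" "\<not> R p' q" "\<not> R p' q'"
    using card sym_R match_R isolated by (rule matching_on_five_vertices[of T R t])
  note path_found = that
  \<comment> \<open>In the 4-cycle \<open>p q p' q'\<close>, the edges of \<open>N\<close> lie in one of the two perfect matchings; the
    path runs through the other one, joined by two edges at \<open>s\<close>.\<close>
  have path: thesis
    if q: "{u, u'} = {q, q'}" "\<not> N p u'" "\<not> N p' u" for u u'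
  \<comment> \<open>As \<open>s\<close> has at most one \<open>N\<close>-neighbour, the edges
    \<open>p u'\<close> and \<open>p' u\<close> can be joined through \<open>u s p\<close> or
    through \<open>u' s p'\<close>.\<close>
  proof (cases "N s u' \<or> N s p'")
    case True
    then have "\<not> N s u" "\<not> N s p"
      using match_N[of s] * q by (auto simp: doubleton_eq_iff)
    then show thesis
      using * q sym_N sym_R by (intro path_found[of p' u s p u']) (auto simp: doubleton_eq_iff)
  next
    case False
    then show thesis
      using * q sym_N sym_R by (intro path_found[of p u' s p' u]) (auto simp: doubleton_eq_iff)
  qed
  show thesis
  proof (cases "N p q' \<or> N p' q")
    case True
    moreover have "p \<noteq> p'" "q \<noteq> q'"
      using * by auto
    ultimately have "\<not> N p q" "\<not> N p' q'"
      using match_N sym_N by blast+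
    then show thesis
      by (intro path[of q' q]) auto
  next
    case False
    then show thesis
      by (intro path[of q q']) auto
  qed
qed

context comm_group
begin

text \<open>Cancellation turns a coincidence of partial products into a block of consecutive
  \<open>b\<close>s with product \<open>\<one>\<close>. Lengths 1, 2 and 5 are excluded directly;
  for lengths 3 and 4 the complementary terms would have product \<open>\<sigma>\<close>, contrary
  to \<open>compl\<close>.\<close>

lemma distinct_partial_products:
  assumes carr: "c \<in> carrier G" "b1 \<in> carrier G" "b2 \<in> carrier G" "b3 \<in> carrier G"
      "b4 \<in> carrier G" "b5 \<in> carrier G"
    and ne: "b1 \<noteq> \<one>" "b2 \<noteq> \<one>" "b3 \<noteq> \<one>" "b4 \<noteq> \<one>" "b5 \<noteq> \<one>"
    and \<sigma>: "\<sigma> = b1 \<otimes> (b2 \<otimes> (b3 \<otimes> (b4 \<otimes> b5)))" "\<sigma> \<noteq> \<one>"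
    and pairs: "b1 \<otimes> b2 \<noteq> \<one>" "b2 \<otimes> b3 \<noteq> \<one>" "b3 \<otimes> b4 \<noteq> \<one>" "b4 \<otimes> b5 \<noteq> \<one>"
    and compl: "b1 \<otimes> b2 \<noteq> \<sigma>" "b4 \<otimes> b5 \<noteq> \<sigma>" "b1 \<otimes> b5 \<noteq> \<sigma>" "b1 \<noteq> \<sigma>" "b5 \<noteq> \<sigma>"
  shows "distinct [c, c \<otimes> b1, c \<otimes> b1 \<otimes> b2, c \<otimes> b1 \<otimes> b2 \<otimes> b3, c \<otimes> b1 \<otimes> b2 \<otimes> b3 \<otimes> b4,
    c \<otimes> b1 \<otimes> b2 \<otimes> b3 \<otimes> b4 \<otimes> b5]"
proof -
  have shift: "x \<noteq> x \<otimes> y" if "y \<noteq> \<one>" "x \<in> carrier G" "y \<in> carrier G" for x y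
    using that by simp
  have "\<sigma> = (b1 \<otimes> (b2 \<otimes> b3)) \<otimes> (b4 \<otimes> b5)" "\<sigma> = (b2 \<otimes> (b3 \<otimes> b4)) \<otimes> (b1 \<otimes> b5)"
      "\<sigma> = (b3 \<otimes> (b4 \<otimes> b5)) \<otimes> (b1 \<otimes> b2)" "\<sigma> = (b1 \<otimes> (b2 \<otimes> (b3 \<otimes> b4))) \<otimes> b5"
      "\<sigma> = (b2 \<otimes> (b3 \<otimes> (b4 \<otimes> b5))) \<otimes> b1"
    using carr \<sigma>(1) by (simp_all add: m_ac)
  then have "b1 \<otimes> (b2 \<otimes> b3) \<noteq> \<one>" "b2 \<otimes> (b3 \<otimes> b4) \<noteq> \<one>" "b3 \<otimes> (b4 \<otimes> b5) \<noteq> \<one>"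
      "b1 \<otimes> (b2 \<otimes> (b3 \<otimes> b4)) \<noteq> \<one>" "b2 \<otimes> (b3 \<otimes> (b4 \<otimes> b5)) \<noteq> \<one>"
    using compl carr by auto
  then show ?thesis
    using carr ne \<sigma> pairs by (simp add: m_assoc shift)
qed

text \<open>Nothing in the argument is special to cyclic groups, so it is carried out in any abelian
  group.\<close>

theorem exists_ordering_distinct_partial_products:
  assumes A: "A \<subseteq> carrier G - {\<one>}" "card A = 6"
  obtains a :: "nat \<Rightarrow> 'a" where "bij_betw a {1..6} A"
    "inj_on (\<lambda>j. finprod G a {1..j}) {1..6}"
proof -
  have fin: "finite A"
    using A(2) by (metis card.infinite zero_neq_numeral)
  define \<pi> where "\<pi> = finprod G (\<lambda>x. x) A"
  have "\<not> A \<subseteq> {\<pi>}"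
    using A(2) card_mono[of "{\<pi>}" A] by auto
  then obtain c where c: "c \<in> A" "c \<noteq> \<pi>"
    by auto
  define T where "T = A - {c}"
  define \<sigma> where "\<sigma> = finprod G (\<lambda>x. x) T"
  have T: "T \<subseteq> carrier G - {\<one>}" "card T = 5" "finite T" "A = insert c T" "c \<notin> T"
    using A fin c by (auto simp: T_def)
  have carr: "c \<in> carrier G" "\<sigma> \<in> carrier G"
    using A c T by (auto simp: \<sigma>_def intro!: finprod_closed)
  have "\<pi> = c \<otimes> \<sigma>"
    using T carr by (auto simp: \<pi>_def \<sigma>_def intro!: finprod_insert)
  then have \<sigma>: "\<sigma> \<noteq> \<one>"
    using c carr by auto
  \<comment> \<open>Membership in \<open>T\<close> is built in because uniqueness of partners rests
    on cancellation in the carrier.\<close>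
  define E where "E w x y \<longleftrightarrow> x \<in> T \<and> y \<in> T \<and> x \<otimes> y = w" for w x y
  have sym: "E w y x" if "E w x y" for w x y
    using that T(1) m_comm unfolding E_def by blast
  have match: "y = z" if "E w x y" "E w x z" for w x y z
    using that T(1) Units_l_cancel[of x y z] by (auto simp: E_def)
  \<comment> \<open>A partner of \<open>\<sigma>\<close> would have to be \<open>\<one>\<close>,
    which is not in \<open>T\<close>.\<close>
  have isolated: "\<not> E \<sigma> \<sigma> x" for x
    using T(1) carr by (auto simp: E_def)
  obtain b1 b2 b3 b4 b5 where b: "distinct [b1, b2, b3, b4, b5]" "set [b1, b2, b3, b4, b5] = T"
    and E: "\<not> E \<one> b1 b2" "\<not> E \<one> b2 b3" "\<not> E \<one> b3 b4" "\<not> E \<one> b4 b5"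
    "\<not> E \<sigma> b1 b2" "\<not> E \<sigma> b4 b5" "\<not> E \<sigma> b1 b5"
    and ends: "b1 \<noteq> \<sigma>" "b5 \<noteq> \<sigma>"
    using T(2) sym match isolated sym match
    by (rule path_avoiding_matchings[of T "E \<sigma>" \<sigma> "E \<one>"])
  have pairs: "b1 \<otimes> b2 \<noteq> \<one>" "b2 \<otimes> b3 \<noteq> \<one>" "b3 \<otimes> b4 \<noteq> \<one>" "b4 \<otimes> b5 \<noteq> \<one>"
    "b1 \<otimes> b2 \<noteq> \<sigma>" "b4 \<otimes> b5 \<noteq> \<sigma>" "b1 \<otimes> b5 \<noteq> \<sigma>"
    using E b(2) by (auto simp: E_def)
  have bcarr: "b1 \<in> carrier G" "b2 \<in> carrier G" "b3 \<in> carrier G" "b4 \<in> carrier G" "b5 \<in> carrier G"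
    and ne: "b1 \<noteq> \<one>" "b2 \<noteq> \<one>" "b3 \<noteq> \<one>" "b4 \<noteq> \<one>" "b5 \<noteq> \<one>"
    using b(2) T(1) by auto
  have \<sigma>_eq: "\<sigma> = b1 \<otimes> (b2 \<otimes> (b3 \<otimes> (b4 \<otimes> b5)))"
    unfolding \<sigma>_def b(2)[symmetric] using b(1) bcarr by simp
  \<comment> \<open>The ordering counts from 1, list positions from 0.\<close>
  define a where "a i = [c, b1, b2, b3, b4, b5] ! (i - 1)" for i :: nat
  have six: "{1..6::nat} = {1, 2, 3, 4, 5, 6}"
    by auto
  have vals: "a 1 = c" "a 2 = b1" "a 3 = b2" "a 4 = b3" "a 5 = b4" "a 6 = b5"
    by (simp_all add: a_def)
  have "a ` {1..6} = A"
    unfolding six using vals T(4) b(2) by simp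
  moreover from this have "inj_on a {1..6}"
    using A(2) by (intro eq_card_imp_inj_on) auto
  ultimately have bij: "bij_betw a {1..6} A"
    by (simp add: bij_betw_def)
  have range: "a i \<in> carrier G" if "1 \<le> i" "i \<le> 6" for i
    using bij_betwE[OF bij] that A(1) by auto
  have step: "finprod G a {1..Suc j} = finprod G a {1..j} \<otimes> a (Suc j)" if "j < 6" for j
  proof -
    have "finprod G a (insert (Suc j) {1..j}) = a (Suc j) \<otimes> finprod G a {1..j}"
      using that range by (intro finprod_insert) auto
    then show ?thesis
      using that range by (subst m_comm) (auto simp: atLeastAtMostSuc_conv intro!: finprod_closed)
  qed
  have "finprod G a {1..1} = c"
    using step[of 0] carr vals by simp
  moreover from this have "finprod G a {1..2} = c \<otimes> b1"
    using step[of 1] vals by (simp add: numeral_2_eq_2)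
  moreover from this have "finprod G a {1..3} = c \<otimes> b1 \<otimes> b2"
    using step[of 2] vals by simp
  moreover from this have "finprod G a {1..4} = c \<otimes> b1 \<otimes> b2 \<otimes> b3"
    using step[of 3] vals by simp
  moreover from this have "finprod G a {1..5} = c \<otimes> b1 \<otimes> b2 \<otimes> b3 \<otimes> b4"
    using step[of 4] vals by simp
  moreover from this have "finprod G a {1..6} = c \<otimes> b1 \<otimes> b2 \<otimes> b3 \<otimes> b4 \<otimes> b5"
    using step[of 5] vals by simp
  ultimately have "map (\<lambda>j. finprod G a {1..j}) [1, 2, 3, 4, 5, 6] =
      [c, c \<otimes> b1, c \<otimes> b1 \<otimes> b2, c \<otimes> b1 \<otimes> b2 \<otimes> b3, c \<otimes> b1 \<otimes> b2 \<otimes> b3 \<otimes> b4,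
       c \<otimes> b1 \<otimes> b2 \<otimes> b3 \<otimes> b4 \<otimes> b5]"
    by simp
  moreover have "distinct \<dots>"
    by (rule distinct_partial_products) (fact carr bcarr ne \<sigma>_eq \<sigma> pairs ends)+
  ultimately have "distinct (map (\<lambda>j. finprod G a {1..j}) [1, 2, 3, 4, 5, 6])"
    by simp
  then have "inj_on (\<lambda>j. finprod G a {1..j}) (set [1, 2, 3, 4, 5, 6])"
    unfolding distinct_map by blast
  then have "inj_on (\<lambda>j. finprod G a {1..j}) {1..6}"
    by (simp only: six list.set)
  with bij that show thesis
    by blast
qed

end

theorem theorem2:
  fixes n :: nat and A :: "int set"
  assumes "n \<ge> 1"
    and "A \<subseteq> carrier (integer_mod_group n) - {\<one>\<^bsub>integer_mod_group n\<^esub>}"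
    and "card A = 6"
  shows "\<exists>a :: nat \<Rightarrow> int. bij_betw a {1..6} A \<and>
    inj_on (\<lambda>j::nat. finprod (integer_mod_group n) a {1..j}) {1..6}"
proof -
  interpret comm_group "integer_mod_group n"
    by (rule abelian_integer_mod_group)
  show ?thesis
    using exists_ordering_distinct_partial_products[OF assms(2,3)] by blast
qed

end
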